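(* Let $F\subset\mathbb{R}^n$ be a nonempty compact convex set with $0\in\operatorname{int}(F)$ and Minkowski gauge $\rho_F$. Let $A=\{a^1,\ldots,a^m\}\subset\mathbb{R}^n$ be a finite set of demand points, with $m\ge2$, let $k$ be an integer with $1\le k\le m$, and let $$f_F(x)=\sum_{i=1}^m\Big(\min_{\ell=1,\ldots,k}\rho_F(x^\ell-a^i)\Big),\qquad x=(x^1,\ldots,x^k)\in\mathbb{R}^{nk}.$$ Let $\bar x=(\bar x^1,\ldots,\bar x^k)\in\mathbb{R}^{nk}$, and suppose that for every $i=1,\ldots,m$ the index set $$L_i(\bar x)=\{\ell\in\{1,\ldots,k\}\mid a^i\in A[\bar x^\ell]\}$$ is a singleton. Then the following statements are equivalent: (a) $\bar x$ is a local optimal solution to the problem of minimizing $f_F$ over $\mathbb{R}^{nk}$. (b) For every $\ell=1,\ldots,k$, if $A[\bar x^\ell]$ is nonempty, then $\bar x^\ell$ is a global optimal solution of the generalized single-source Weber problem defined by the data set $A[\bar x^\ell]$, i.e. $\bar x^\ell$ minimizes $$\varphi_F^\ell(y)=\sum_{i\in I(\bar x^\ell)}\rho_F(y-a^i)$$ over all $y\in\mathbb{R}^n$, where $I(\bar x^\ell)=\{i\in\{1,\ldots,m\}\mid a^i\in A[\bar x^\ell]\}$.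
   Context: The Minkowski function (gauge) of $F$ is $\rho_F(x)=\inf\{t\ge 0\mid x\in tF\}$, $x\in\mathbb{R}^n$; $F$ is not assumed symmetric. For $x=(x^1,\ldots,x^k)\in\mathbb{R}^{nk}$ and $\ell\in\{1,\ldots,k\}$, define the attraction set $$A[x^\ell]=\Big\{a^i\in A\;\Big|\;\rho_F(x^\ell-a^i)=\min_{r=1,\ldots,k}\rho_F(x^r-a^i)\Big\}$$ (this depends on the whole vector $x$ and the index $\ell$). A vector $\bar x=(\bar x^1,\ldots,\bar x^k)\in\mathbb{R}^{nk}$ is a local optimal solution if there exists $\epsilon>0$ such that $f_F(\bar x)\le f_F(x)$ for all $x=(x^1,\ldots,x^k)\in\mathbb{R}^{nk}$ satisfying $\|x^\ell-\bar x^\ell\|<\epsilon$ (Euclidean norm) for all $\ell=1,\ldots,k$. *)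

theory Defs
  imports "HOL-Analysis.Analysis"
begin

definition minkowski_gauge :: "'a::real_vector set \<Rightarrow> 'a \<Rightarrow> real" where
  "minkowski_gauge F x = Inf {t. 0 \<le> t \<and> x \<in> (\<lambda>y. t *\<^sub>R y) ` F}"

text \<open>
  A vector \<open>(x\<^sup>1, \<dots>, x\<^sup>k)\<close> of \<open>k\<close> centres is a function on \<open>nat\<close> of which only the values
  at \<open>1, \<dots>, k\<close> are used; likewise the family \<open>a\<^sup>1, \<dots>, a\<^sup>m\<close> of demand points.
\<close>

definition multi_weber ::
  "'a::real_vector set \<Rightarrow> nat \<Rightarrow> (nat \<Rightarrow> 'a) \<Rightarrow> nat \<Rightarrow> (nat \<Rightarrow> 'a) \<Rightarrow> real" where
  "multi_weber F m a k x =
     (\<Sum>i=1..m. MIN l\<in>{1..k}. minkowski_gauge F (x l - a i))"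

definition attraction_set ::
  "'a::real_vector set \<Rightarrow> 'a set \<Rightarrow> nat \<Rightarrow> (nat \<Rightarrow> 'a) \<Rightarrow> nat \<Rightarrow> 'a set" where
  "attraction_set F A k x l =
     {p \<in> A. minkowski_gauge F (x l - p) = (MIN r\<in>{1..k}. minkowski_gauge F (x r - p))}"

definition attracting_indices ::
  "'a::real_vector set \<Rightarrow> nat \<Rightarrow> (nat \<Rightarrow> 'a) \<Rightarrow> nat \<Rightarrow> (nat \<Rightarrow> 'a) \<Rightarrow> nat \<Rightarrow> nat set" where
  "attracting_indices F m a k x i =
     {l \<in> {1..k}. a i \<in> attraction_set F (a ` {1..m}) k x l}"

definition attracted_indices ::
  "'a::real_vector set \<Rightarrow> nat \<Rightarrow> (nat \<Rightarrow> 'a) \<Rightarrow> nat \<Rightarrow> (nat \<Rightarrow> 'a) \<Rightarrow> nat \<Rightarrow> nat set" where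
  "attracted_indices F m a k x l =
     {i \<in> {1..m}. a i \<in> attraction_set F (a ` {1..m}) k x l}"

definition weber_cluster ::
  "'a::real_vector set \<Rightarrow> nat \<Rightarrow> (nat \<Rightarrow> 'a) \<Rightarrow> nat \<Rightarrow> (nat \<Rightarrow> 'a) \<Rightarrow> nat \<Rightarrow> 'a \<Rightarrow> real" where
  "weber_cluster F m a k x l y =
     (\<Sum>i\<in>attracted_indices F m a k x l. minkowski_gauge F (y - a i))"

definition local_optimal ::
  "nat \<Rightarrow> ((nat \<Rightarrow> 'a::real_normed_vector) \<Rightarrow> real) \<Rightarrow> (nat \<Rightarrow> 'a) \<Rightarrow> bool" where
  "local_optimal k f xbar \<longleftrightarrow>
     (\<exists>\<epsilon>>0. \<forall>x. (\<forall>l\<in>{1..k}. norm (x l - xbar l) < \<epsilon>) \<longrightarrow> f xbar \<le> f x)"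

definition global_optimal :: "('a \<Rightarrow> real) \<Rightarrow> 'a \<Rightarrow> bool" where
  "global_optimal f xbar \<longleftrightarrow> (\<forall>y. f xbar \<le> f y)"

end

theory Submission
  imports Defs
begin

text \<open>
  The gauge is a finite convex function, hence continuous. Since every demand point has exactly one
  closest centre at \<open>xbar\<close>, continuity keeps the assignment of demand points to centres fixed near
  \<open>xbar\<close>, so there the objective decouples into the sum of the convex single-source Weber
  functions of the clusters. A local minimum of the decoupled sum is a local minimum in each
  coordinate, and by convexity a local minimum of a Weber function is global.
\<close>

lemma minkowski_gauge_le:
  assumes "0 \<le> t" "y \<in> F"
  shows "minkowski_gauge F (t *\<^sub>R y) \<le> t"
  unfolding minkowski_gauge_def
  by (rule cInf_lower) (use assms in \<open>auto intro: bdd_belowI[of _ 0]\<close>)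

text \<open>A neighbourhood of 0 inside \<open>F\<close> absorbs every \<open>x\<close>, so the set
  of admissible scalings is nonempty and some member lies below any number above its
  infimum.\<close>

lemma minkowski_gauge_approx:
  fixes F :: "'a::real_normed_vector set"
  assumes "0 \<in> interior F" "0 < e"
  obtains t y where "0 \<le> t" "y \<in> F" "x = t *\<^sub>R y" "t < minkowski_gauge F x + e"
proof -
  let ?T = "{t. 0 \<le> t \<and> x \<in> (\<lambda>y. t *\<^sub>R y) ` F}"
  obtain r where r: "0 < r" "ball 0 r \<subseteq> F"
    using assms(1) by (meson mem_interior)
  \<comment> \<open>Scaling by \<open>1 / s\<close> turns \<open>norm x\<close> into
    \<open>r * norm x / (norm x + 1)\<close>, which is below \<open>r\<close>; the summand 1 keeps
    \<open>s\<close> positive at \<open>x = 0\<close>.\<close>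
  define s where "s = (norm x + 1) / r"
  have s: "0 < s"
    using r by (simp add: s_def add_nonneg_pos)
  have "norm (x /\<^sub>R s) < r"
    using r by (simp add: s_def divide_simps add_nonneg_pos mult_strict_left_mono)
  then have "x /\<^sub>R s \<in> F"
    using r by auto
  then have "s \<in> ?T"
    using s by (auto intro!: image_eqI[of _ _ "x /\<^sub>R s"])
  moreover have "Inf ?T < minkowski_gauge F x + e"
    using assms(2) by (simp add: minkowski_gauge_def)
  ultimately obtain t where "t \<in> ?T" "t < minkowski_gauge F x + e"
    using cInf_lessD[of ?T] by blast
  then show thesis
    using that by blast
qed

lemma convex_on_minkowski_gauge:
  fixes F :: "'a::real_normed_vector set"
  assumes "convex F" "0 \<in> interior F"
  shows "convex_on UNIV (minkowski_gauge F)"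
proof (rule convex_onI)
  fix \<mu> :: real and x y :: 'a
  assume \<mu>: "0 < \<mu>" "\<mu> < 1"
  let ?g = "minkowski_gauge F"
  show "?g ((1 - \<mu>) *\<^sub>R x + \<mu> *\<^sub>R y) \<le> (1 - \<mu>) * ?g x + \<mu> * ?g y"
  proof (rule field_le_epsilon)
    fix e :: real
    assume "0 < e"
    obtain s p where s: "0 \<le> s" "p \<in> F" "x = s *\<^sub>R p" "s < ?g x + e"
      using minkowski_gauge_approx[OF assms(2) \<open>0 < e\<close>] .
    obtain t q where t: "0 \<le> t" "q \<in> F" "y = t *\<^sub>R q" "t < ?g y + e"
      using minkowski_gauge_approx[OF assms(2) \<open>0 < e\<close>] .
    define u where "u = (1 - \<mu>) * s"
    define v where "v = \<mu> * t"
    have uv: "0 \<le> u" "0 \<le> v"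
      using \<mu> s t by (auto simp: u_def v_def)
    \<comment> \<open>This is the inclusion of \<open>u F + v F\<close> in \<open>(u + v) F\<close>
      for convex \<open>F\<close>. Normalising the weights needs \<open>u + v\<close> nonzero;
      otherwise both weights vanish and \<open>p\<close> itself serves as \<open>z\<close>.\<close>
    have "\<exists>z\<in>F. u *\<^sub>R p + v *\<^sub>R q = (u + v) *\<^sub>R z"
    proof (cases "u + v = 0")
      case True
      then show ?thesis
        using uv s(2) by (auto simp: add_nonneg_eq_0_iff)
    next
      case False
      let ?z = "(u / (u + v)) *\<^sub>R p + (v / (u + v)) *\<^sub>R q"
      have "?z \<in> F"
        using uv False s t
        by (intro convexD[OF assms(1)]) (auto simp flip: add_divide_distrib)
      moreover have "u *\<^sub>R p + v *\<^sub>R q = (u + v) *\<^sub>R ?z"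
        using False by (simp add: scaleR_add_right)
      ultimately show ?thesis by blast
    qed
    then obtain z where "z \<in> F" "u *\<^sub>R p + v *\<^sub>R q = (u + v) *\<^sub>R z" ..
    then have "?g ((1 - \<mu>) *\<^sub>R x + \<mu> *\<^sub>R y) \<le> u + v"
      using minkowski_gauge_le[of "u + v" z F] uv s(3) t(3) by (simp add: u_def v_def)
    \<comment> \<open>The two errors carry weights \<open>1 - \<mu>\<close> and
      \<open>\<mu>\<close>, so together they cost exactly one \<open>e\<close>.\<close>
    also have "\<dots> \<le> (1 - \<mu>) * (?g x + e) + \<mu> * (?g y + e)"
      unfolding u_def v_def using \<mu> s t by (intro add_mono mult_left_mono) auto
    finally show "?g ((1 - \<mu>) *\<^sub>R x + \<mu> *\<^sub>R y) \<le> (1 - \<mu>) * ?g x + \<mu> * ?g y + e"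
      by (simp add: algebra_simps)
  qed
qed auto

lemma convex_on_minkowski_gauge_translate:
  fixes F :: "'a::real_normed_vector set"
  assumes "convex F" "0 \<in> interior F"
  shows "convex_on UNIV (\<lambda>y. minkowski_gauge F (y - b))"
proof (rule convex_onI)
  fix t :: real and x y :: 'a
  assume "0 < t" "t < 1"
  moreover have "(1 - t) *\<^sub>R x + t *\<^sub>R y - b = (1 - t) *\<^sub>R (x - b) + t *\<^sub>R (y - b)"
    by (simp add: algebra_simps)
  ultimately show "minkowski_gauge F ((1 - t) *\<^sub>R x + t *\<^sub>R y - b)
      \<le> (1 - t) * minkowski_gauge F (x - b) + t * minkowski_gauge F (y - b)"
    using convex_onD[OF convex_on_minkowski_gauge[OF assms], of t "x - b" "y - b"] by simp
qed auto

lemma convex_on_weber_cluster: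
  fixes F :: "'a::real_normed_vector set"
  assumes "convex F" "0 \<in> interior F"
  shows "convex_on UNIV (weber_cluster F m a k x l)"
proof -
  have "convex_on UNIV (\<lambda>y. \<Sum>i\<in>I. minkowski_gauge F (y - a i))" if "finite I" for I
    using that
    by induction (auto intro!: convex_on_add convex_on_minkowski_gauge_translate assms
        simp: convex_on_const)
  moreover have "finite (attracted_indices F m a k x l)"
    by (simp add: attracted_indices_def)
  ultimately show ?thesis
    by (simp add: weber_cluster_def[abs_def])
qed

text \<open>A finite convex function on an open subset of a finite-dimensional space is continuous;
  hence the sort \<open>euclidean_space\<close> from here on.\<close>

lemma continuous_on_minkowski_gauge:
  fixes F :: "'a::euclidean_space set"
  assumes "convex F" "0 \<in> interior F"
  shows "continuous_on UNIV (minkowski_gauge F)"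
  by (rule convex_on_continuous[OF open_UNIV convex_on_minkowski_gauge[OF assms]])

text \<open>A strict inequality between continuous functions survives small perturbations. The
  filter form lets finitely many such claims be merged into one with a common radius.\<close>

lemma eventually_gauge_order_stable:
  fixes F :: "'a::euclidean_space set"
  assumes "convex F" "0 \<in> interior F"
    and less: "minkowski_gauge F (p - b) < minkowski_gauge F (q - b)"
  shows "\<forall>\<^sub>F d in at_right 0. \<forall>u v. norm (u - p) < d \<longrightarrow> norm (v - q) < d \<longrightarrow>
    minkowski_gauge F (u - b) < minkowski_gauge F (v - b)"
proof -
  let ?g = "\<lambda>y. minkowski_gauge F (y - b)"
  \<comment> \<open>Half the gap: changes smaller than \<open>e\<close> leave the two values on
    opposite sides of their midpoint.\<close>
  define e where "e = (?g q - ?g p) / 2"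
  have "0 < e"
    using less by (simp add: e_def)
  have cont: "isCont ?g y" for y
    using continuous_on_compose2[OF continuous_on_minkowski_gauge[OF assms(1,2)],
        of UNIV "\<lambda>y. y - b"]
    by (auto simp: continuous_on_eq_continuous_at intro!: continuous_intros)
  obtain d1 where d1: "0 < d1" "\<And>u. norm (u - p) < d1 \<Longrightarrow> \<bar>?g u - ?g p\<bar> < e"
    using cont[of p] \<open>0 < e\<close> unfolding continuous_at_eps_delta dist_norm real_norm_def by metis
  obtain d2 where d2: "0 < d2" "\<And>v. norm (v - q) < d2 \<Longrightarrow> \<bar>?g v - ?g q\<bar> < e"
    using cont[of q] \<open>0 < e\<close> unfolding continuous_at_eps_delta dist_norm real_norm_def by metis
  have "?g u < ?g v" if "norm (u - p) < d1" "norm (v - q) < d2" for u v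
    using d1(2)[OF that(1)] d2(2)[OF that(2)] unfolding e_def abs_less_iff by argo
  then show ?thesis
    unfolding eventually_at_right_field
    by (intro exI[of _ "min d1 d2"]) (use d1(1) d2(1) in auto)
qed

lemma multi_weber_locally_decouples:
  fixes F :: "'a::euclidean_space set"
  assumes "convex F" "0 \<in> interior F"
    and single: "\<And>i. i \<in> {1..m} \<Longrightarrow> is_singleton (attracting_indices F m a k xbar i)"
  obtains \<epsilon> where "0 < \<epsilon>"
    "\<And>x. (\<And>l. l \<in> {1..k} \<Longrightarrow> norm (x l - xbar l) < \<epsilon>) \<Longrightarrow>
      multi_weber F m a k x = (\<Sum>l=1..k. weber_cluster F m a k xbar l (x l))"
proof -
  let ?g = "minkowski_gauge F"
  define \<sigma> where "\<sigma> i = the_elem (attracting_indices F m a k xbar i)" for i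
  have \<sigma>: "attracting_indices F m a k xbar i = {\<sigma> i}" if "i \<in> {1..m}" for i
    using single[OF that] by (simp add: \<sigma>_def is_singleton_the_elem)
  have mem_iff: "a i \<in> attraction_set F (a ` {1..m}) k xbar l \<longleftrightarrow> l = \<sigma> i"
    if "i \<in> {1..m}" "l \<in> {1..k}" for i l
    using \<sigma>[OF that(1)] that(2) by (auto simp: attracting_indices_def)
  have \<sigma>_in: "\<sigma> i \<in> {1..k}" if "i \<in> {1..m}" for i
    using \<sigma>[OF that] unfolding attracting_indices_def by blast
  \<comment> \<open>The inequality is strict because only \<open>\<sigma> i\<close> attains the
    minimum at \<open>a i\<close>; strictness is what stability requires.\<close>
  have less: "?g (xbar (\<sigma> i) - a i) < ?g (xbar l - a i)"
    if "i \<in> {1..m}" "l \<in> {1..k}" "l \<noteq> \<sigma> i" for i l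
  proof -
    have "(MIN r\<in>{1..k}. ?g (xbar r - a i)) \<le> ?g (xbar l - a i)"
      using that by (intro Min_le) auto
    moreover have "?g (xbar (\<sigma> i) - a i) = (MIN r\<in>{1..k}. ?g (xbar r - a i))"
      using mem_iff[OF that(1) \<sigma>_in[OF that(1)]] by (auto simp: attraction_set_def)
    moreover have "?g (xbar l - a i) \<noteq> (MIN r\<in>{1..k}. ?g (xbar r - a i))"
      using mem_iff[OF that(1,2)] that by (auto simp: attraction_set_def)
    ultimately show ?thesis by linarith
  qed
  \<comment> \<open>There are finitely many pairs of a demand point and a competing centre, so one
    radius works for all.\<close>
  have "\<forall>\<^sub>F d in at_right 0. \<forall>i\<in>{1..m}. \<forall>l\<in>{1..k} - {\<sigma> i}.
      \<forall>u v. norm (u - xbar (\<sigma> i)) < d \<longrightarrow> norm (v - xbar l) < d \<longrightarrow> ?g (u - a i) < ?g (v - a i)"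
    (is "eventually ?stable _")
    by (intro eventually_ball_finite ballI eventually_gauge_order_stable assms less) auto
  then have "\<forall>\<^sub>F d in at_right 0. ?stable d \<and> 0 < d"
    by (intro eventually_conj eventually_at_right_less)
  then obtain \<epsilon> where "?stable \<epsilon>" "0 < \<epsilon>"
    using eventually_happens'[OF trivial_limit_at_right_real] by force
  then have \<epsilon>: "?g (u - a i) < ?g (v - a i)"
    if "i \<in> {1..m}" "l \<in> {1..k}" "l \<noteq> \<sigma> i"
      "norm (u - xbar (\<sigma> i)) < \<epsilon>" "norm (v - xbar l) < \<epsilon>" for i l u v
    using that by (meson DiffI singletonD)
  have "multi_weber F m a k x = (\<Sum>l=1..k. weber_cluster F m a k xbar l (x l))"
    if x: "\<And>l. l \<in> {1..k} \<Longrightarrow> norm (x l - xbar l) < \<epsilon>" for x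
  proof -
    have "(MIN l\<in>{1..k}. ?g (x l - a i)) = ?g (x (\<sigma> i) - a i)" if i: "i \<in> {1..m}" for i
    proof (rule Min_eqI)
      fix y
      assume "y \<in> (\<lambda>l. ?g (x l - a i)) ` {1..k}"
      then obtain l where l: "l \<in> {1..k}" "y = ?g (x l - a i)" by blast
      show "?g (x (\<sigma> i) - a i) \<le> y"
        using \<epsilon>[OF i l(1) _ x[OF \<sigma>_in[OF i]] x[OF l(1)]] l(2) by (cases "l = \<sigma> i") auto
    qed (use \<sigma>_in[OF i] in auto)
    then have "multi_weber F m a k x = (\<Sum>i=1..m. ?g (x (\<sigma> i) - a i))"
      by (simp add: multi_weber_def)
    \<comment> \<open>The sum is regrouped by the fibres of \<open>\<sigma>\<close>. By
      \<open>mem_iff\<close> the fibre over \<open>l\<close> is the cluster of \<open>l\<close>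
      taken at \<open>xbar\<close>, not at \<open>x\<close>.\<close>
    also have "\<dots> = (\<Sum>l=1..k. \<Sum>i\<in>{i \<in> {1..m}. \<sigma> i = l}. ?g (x (\<sigma> i) - a i))"
      using \<sigma>_in by (intro sum.group[symmetric]) auto
    also have "\<dots> = (\<Sum>l=1..k. weber_cluster F m a k xbar l (x l))"
      unfolding weber_cluster_def attracted_indices_def
      by (intro sum.cong) (auto simp: mem_iff simp del: atLeastAtMost_iff One_nat_def)
    finally show ?thesis .
  qed
  with \<open>0 < \<epsilon>\<close> show thesis
    using that by blast
qed

theorem theorem3p9:
  fixes F :: "(real ^ 'n) set"
    and a :: "nat \<Rightarrow> real ^ 'n"
    and xbar :: "nat \<Rightarrow> real ^ 'n"
    and m k :: nat
  assumes "F \<noteq> {}" and "compact F" and "convex F" and "0 \<in> interior F"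
    and "2 \<le> m" and "1 \<le> k" and "k \<le> m"
    and "\<And>i. i \<in> {1..m} \<Longrightarrow> is_singleton (attracting_indices F m a k xbar i)"
  shows "local_optimal k (multi_weber F m a k) xbar \<longleftrightarrow>
    (\<forall>l\<in>{1..k}. attraction_set F (a ` {1..m}) k xbar l \<noteq> {} \<longrightarrow>
       global_optimal (weber_cluster F m a k xbar l) (xbar l))"
proof -
  let ?f = "multi_weber F m a k" and ?\<phi> = "weber_cluster F m a k xbar"
  obtain \<epsilon> where "0 < \<epsilon>" and dec: "\<And>x. (\<And>l. l \<in> {1..k} \<Longrightarrow> norm (x l - xbar l) < \<epsilon>) \<Longrightarrow>
      ?f x = (\<Sum>l=1..k. ?\<phi> l (x l))"
    using multi_weber_locally_decouples[OF assms(3,4,8)] by blast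
  have dec_xbar: "?f xbar = (\<Sum>l=1..k. ?\<phi> l (xbar l))"
    using \<open>0 < \<epsilon>\<close> by (intro dec) simp
  show ?thesis
  proof (intro iffI ballI impI)
    fix l
    assume "local_optimal k ?f xbar" and l: "l \<in> {1..k}"
    then obtain \<delta> where "0 < \<delta>"
      and \<delta>: "\<And>x. (\<And>l. l \<in> {1..k} \<Longrightarrow> norm (x l - xbar l) < \<delta>) \<Longrightarrow> ?f xbar \<le> ?f x"
      unfolding local_optimal_def by blast
    \<comment> \<open>Only centre \<open>l\<close> is moved. Radius \<open>\<epsilon>\<close> keeps
      the decoupled formula valid and \<open>\<delta>\<close> gives optimality; the terms of all
      other centres then cancel.\<close>
    have "?\<phi> l (xbar l) \<le> ?\<phi> l y" if "y \<in> ball (xbar l) (min \<epsilon> \<delta>)" for y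
    proof -
      let ?x = "xbar(l := y)"
      have near: "norm (?x j - xbar j) < \<epsilon>" "norm (?x j - xbar j) < \<delta>" for j
        using that \<open>0 < \<epsilon>\<close> \<open>0 < \<delta>\<close> by (auto simp: dist_norm norm_minus_commute)
      have "(\<Sum>j=1..k. ?\<phi> j (xbar j)) \<le> (\<Sum>j=1..k. ?\<phi> j (?x j))"
        using \<delta>[of ?x] dec[of ?x] near dec_xbar by metis
      moreover have "(\<Sum>j\<in>{1..k} - {l}. ?\<phi> j (?x j)) = (\<Sum>j\<in>{1..k} - {l}. ?\<phi> j (xbar j))"
        by (intro sum.cong) auto
      ultimately show ?thesis
        using sum.remove[of "{1..k}" l "\<lambda>j. ?\<phi> j (xbar j)"]
          sum.remove[of "{1..k}" l "\<lambda>j. ?\<phi> j (?x j)"] l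
        by (simp only: finite_atLeastAtMost fun_upd_same)
    qed
    \<comment> \<open>Convexity of the cluster function promotes its minimum over the ball to a
      global one.\<close>
    then have "\<forall>y\<in>UNIV. ?\<phi> l (xbar l) \<le> ?\<phi> l y"
      using \<open>0 < \<epsilon>\<close> \<open>0 < \<delta>\<close>
        convex_local_global_minimum[OF _ convex_on_weber_cluster[OF assms(3,4)] subset_UNIV]
      by (metis min_less_iff_conj)
    then show "global_optimal (?\<phi> l) (xbar l)"
      by (simp add: global_optimal_def)
  next
    assume opt: "\<forall>l\<in>{1..k}. attraction_set F (a ` {1..m}) k xbar l \<noteq> {} \<longrightarrow>
      global_optimal (?\<phi> l) (xbar l)"
    have le: "?\<phi> l (xbar l) \<le> ?\<phi> l y" if "l \<in> {1..k}" for l y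
    \<comment> \<open>A centre attracting no demand point has an empty sum as its cluster function,
      so both sides are 0.\<close>
    proof (cases "attraction_set F (a ` {1..m}) k xbar l = {}")
      case True
      then show ?thesis
        by (simp add: weber_cluster_def attracted_indices_def)
    next
      case False
      then show ?thesis
        using opt that by (simp add: global_optimal_def)
    qed
    show "local_optimal k ?f xbar"
      unfolding local_optimal_def
    \<comment> \<open>The decoupling radius itself witnesses local optimality, since each summand is
      minimised separately at \<open>xbar l\<close>.\<close>
    proof (intro exI[of _ \<epsilon>] conjI allI impI)
      fix x
      assume "\<forall>l\<in>{1..k}. norm (x l - xbar l) < \<epsilon>"
      then have "?f x = (\<Sum>l=1..k. ?\<phi> l (x l))"
        by (intro dec) blast
      then show "?f xbar \<le> ?f x"
        unfolding dec_xbar by (auto intro!: sum_mono le)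
    qed (rule \<open>0 < \<epsilon>\<close>)
  qed
qed

end
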